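(* Let $(M^3,g)$ be a 3-dimensional connected oriented Lorentzian manifold and let $\alpha\colon I\to M^3$ ($I$ an open interval) be a null, non-degenerate and pseudo-arc length parametrized curve, with Frenet frame $(\mathbf L,\mathbf N,\mathbf W)$ and pseudo-torsion $\tau$. Then the parametrization of $\alpha$ is equi-affine arc length (that is, $\mu=1$ identically), and the Cartan frame $(\mathbf e_1,\mathbf e_2,\mathbf e_3)$ of $\alpha$ is given by $$\mathbf e_1=\mathbf L,\qquad \mathbf e_2=\mathbf W,\qquad \mathbf e_3=-\tau\mathbf L-\mathbf N.$$ Moreover, the equi-affine curvatures $\varkappa_1,\varkappa_2$ of $\alpha$ are given by $$\varkappa_1=-\tau',\qquad \varkappa_2=-2\tau.$$
   Context: Let $(M^3,g)$ be a connected oriented 3-dimensional Lorentzian manifold (signature $(++-)$), $\nabla$ its Levi-Civita connection, and $\Omega$ its natural volume form compatible with the orientation, i.e. in positively oriented local coordinates $\Omega(\partial_i,\partial_j,\partial_k)=\sqrt{|\det[g_{ij}]|}\,\varepsilon_{ijk}$ with $\varepsilon_{ijk}$ the Levi-Civita symbol (so $\Omega=1$ on positively oriented orthonormal frames). $(M^3,\nabla,\Omega)$ is regarded as an equi-affine manifold. Put $\nabla^2_{\alpha'}\alpha'=\nabla_{\alpha'}(\nabla_{\alpha'}\alpha')$. A smooth curve $\alpha$ is null if $g(\alpha',\alpha')=0$ with $\alpha'\ne0$, and non-degenerate if $\Omega(\alpha',\nabla_{\alpha'}\alpha',\nabla^2_{\alpha'}\alpha')\neq0$ at every point (equivalently $\alpha',\nabla_{\alpha'}\alpha',\nabla^2_{\alpha'}\alpha'$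 are linearly independent at every point). For a null non-degenerate curve one has $g(\nabla_{\alpha'}\alpha',\nabla_{\alpha'}\alpha')>0$; the curve is pseudo-arc length parametrized if $g(\nabla_{\alpha'}\alpha',\nabla_{\alpha'}\alpha')=1$ at every point. For a null, non-degenerate, pseudo-arc length parametrized curve, the pseudo-torsion is $\tau=\frac12 g(\nabla^2_{\alpha'}\alpha',\nabla^2_{\alpha'}\alpha')$, and the Frenet frame $(\mathbf L,\mathbf N,\mathbf W)$ is defined by $\mathbf L=\alpha'$, $\mathbf W=\nabla_{\alpha'}\alpha'$, $\mathbf N=-\nabla^2_{\alpha'}\alpha'-\tau\alpha'$. It satisfies $\nabla_{\alpha'}\mathbf L=\mathbf W$, $\nabla_{\alpha'}\mathbf N=\tau\mathbf W$, $\nabla_{\alpha'}\mathbf W=-\tau\mathbf L-\mathbf N$. Equi-affine objects: the equi-affine speed is $\mu=|\Omega(\alpha',\nabla_{\alpha'}\alpha',\nabla^2_{\alpha'}\alpha')|^{1/6}$, and $\varphi=1/\mu$; the equi-affine arc length is $\sigma(t)=\int_{t_0}^t\mu(u)\,du$, so the parametrization is equi-affine arc length when $\mu\equiv1$. The Cartan frame is $\mathbf e_1=\varphi\alpha'$, $\mathbf e_2=\nabla_{\mathbf e_1}\mathbf e_1$, $\mathbf e_3=\nabla_{\mathbf e_1}\mathbf e_2$, where $\nabla_{\mathbf e_1}=\varphi\nabla_{\alpha'}$. The equi-affine curvatures $\varkappa_1,\varkappa_2$ are the unique functions on $I$ with $\nabla_{\mathbf e_1}\mathbf e_3=\varkappa_1\mathbf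 e_1+\varkappa_2\mathbf e_2$. A prime on a function denotes the derivative with respect to the parameter. *)

theory Defs
  imports "HOL-Analysis.Analysis"
begin

section \<open>Smooth maps\<close>

primrec Ck_on :: "nat \<Rightarrow> ('a::real_normed_vector \<Rightarrow> 'b::real_normed_vector) \<Rightarrow> 'a set \<Rightarrow> bool" where
  "Ck_on 0 f S \<longleftrightarrow> continuous_on S f"
| "Ck_on (Suc k) f S \<longleftrightarrow> (\<forall>x\<in>S. f differentiable (at x)) \<and>
     (\<forall>v. Ck_on k (\<lambda>x. frechet_derivative f (at x) v) S)"

text \<open>Only meant for open domains \<open>S\<close>: the derivatives are taken in the ambient space.\<close>

definition smooth_on ::
    "'a::real_normed_vector set \<Rightarrow> ('a \<Rightarrow> 'b::real_normed_vector) \<Rightarrow> bool" where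
  "smooth_on S f \<longleftrightarrow> (\<forall>k. Ck_on k f S)"


section \<open>Smooth oriented 3-manifolds\<close>

text \<open>A chart is a pair of its domain and its coordinate map; the values of the coordinate map
  outside the domain are irrelevant.\<close>

type_synonym 'a chart = "'a set \<times> ('a \<Rightarrow> real ^ 3)"

abbreviation cdom :: "'a chart \<Rightarrow> 'a set" where "cdom \<equiv> fst"
abbreviation cmap :: "'a chart \<Rightarrow> 'a \<Rightarrow> real ^ 3" where "cmap \<equiv> snd"
abbreviation cimg :: "'a chart \<Rightarrow> (real ^ 3) set" where "cimg c \<equiv> cmap c ` cdom c"
abbreviation cinv :: "'a chart \<Rightarrow> real ^ 3 \<Rightarrow> 'a" where "cinv c \<equiv> inv_into (cdom c) (cmap c)"

definition transition ::
    "'a chart \<Rightarrow> 'a chart \<Rightarrow> real ^ 3 \<Rightarrow> real ^ 3" where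
  "transition c d = cmap d \<circ> cinv c"

definition dtrans ::
    "'a chart \<Rightarrow> 'a chart \<Rightarrow> 'a \<Rightarrow> real ^ 3 \<Rightarrow> real ^ 3" where
  "dtrans c d p = frechet_derivative (transition c d) (at (cmap c p))"

definition smooth_atlas :: "'a topology \<Rightarrow> 'a chart set \<Rightarrow> bool" where
  "smooth_atlas M A \<longleftrightarrow>
     (\<Union>c\<in>A. cdom c) = topspace M \<and>
     (\<forall>c\<in>A. openin M (cdom c) \<and> open (cimg c) \<and>
        homeomorphic_map (subtopology M (cdom c)) (top_of_set (cimg c)) (cmap c)) \<and>
     (\<forall>c\<in>A. \<forall>d\<in>A. smooth_on (cmap c ` (cdom c \<inter> cdom d)) (transition c d))"

text \<open>The orientation is the one for which all charts of the atlas are positively oriented.\<close>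

definition oriented_atlas :: "'a chart set \<Rightarrow> bool" where
  "oriented_atlas A \<longleftrightarrow>
     (\<forall>c\<in>A. \<forall>d\<in>A. \<forall>p \<in> cdom c \<inter> cdom d. det (matrix (dtrans c d p)) > 0)"

definition connected_oriented_3_manifold ::
    "'a topology \<Rightarrow> 'a chart set \<Rightarrow> bool" where
  "connected_oriented_3_manifold M A \<longleftrightarrow>
     Hausdorff_space M \<and> second_countable M \<and> connected_space M \<and>
     smooth_atlas M A \<and> oriented_atlas A"


section \<open>Tangent vectors\<close>

text \<open>A tangent vector at \<open>p\<close> is given by its components in all charts around \<open>p\<close>, subject
  to the usual transformation law; the components in all other charts are set to zero.
  The type \<open>'a tvec\<close> is the vector space of arbitrary families of components; the vectors
  obeying the law at \<open>p\<close> form \<open>tangent_space A p\<close>.\<close>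

datatype 'a tvec = Tvec (tcomp: "'a chart \<Rightarrow> real ^ 3")

instantiation tvec :: (type) real_vector
begin

definition "0 = Tvec (\<lambda>c. 0)"
definition "u + v = Tvec (\<lambda>c. tcomp u c + tcomp v c)"
definition "- u = Tvec (\<lambda>c. - tcomp u c)"
definition "u - v = Tvec (\<lambda>c. tcomp u c - tcomp v c)"
definition "r *\<^sub>R u = Tvec (\<lambda>c. r *\<^sub>R tcomp u c)"

instance
  by standard (auto simp: zero_tvec_def plus_tvec_def uminus_tvec_def minus_tvec_def
      scaleR_tvec_def algebra_simps)

end

definition tangent_space :: "'a chart set \<Rightarrow> 'a \<Rightarrow> 'a tvec set" where
  "tangent_space A p = {v.
     (\<forall>c. \<not> (c \<in> A \<and> p \<in> cdom c) \<longrightarrow> tcomp v c = 0) \<and>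
     (\<forall>c\<in>A. \<forall>d\<in>A. p \<in> cdom c \<inter> cdom d \<longrightarrow> tcomp v d = dtrans c d p (tcomp v c))}"

text \<open>The coordinate vector $\partial_i$ of the chart \<open>c\<close> at \<open>p\<close>.\<close>

definition coord_vec ::
    "'a chart set \<Rightarrow> 'a chart \<Rightarrow> 'a \<Rightarrow> 3 \<Rightarrow> 'a tvec" where
  "coord_vec A c p i =
     Tvec (\<lambda>d. if d \<in> A \<and> p \<in> cdom d then dtrans c d p (axis i 1) else 0)"


section \<open>Lorentzian metrics\<close>

type_synonym 'a metric_tensor = "'a \<Rightarrow> 'a tvec \<Rightarrow> 'a tvec \<Rightarrow> real"

definition metric_matrix ::
    "'a chart set \<Rightarrow> 'a metric_tensor \<Rightarrow> 'a chart \<Rightarrow> real ^ 3 \<Rightarrow> real ^ 3 ^ 3" where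
  "metric_matrix A g c x =
     (\<chi> i j. g (cinv c x) (coord_vec A c (cinv c x) i) (coord_vec A c (cinv c x) j))"

text \<open>The last condition at each point says that the signature is $(++-)$.\<close>

definition lorentzian_metric ::
    "'a topology \<Rightarrow> 'a chart set \<Rightarrow> 'a metric_tensor \<Rightarrow> bool" where
  "lorentzian_metric M A g \<longleftrightarrow>
     (\<forall>p \<in> topspace M.
        (\<forall>u \<in> tangent_space A p. \<forall>v \<in> tangent_space A p. g p u v = g p v u) \<and>
        (\<forall>u \<in> tangent_space A p. \<forall>v \<in> tangent_space A p. \<forall>w \<in> tangent_space A p. \<forall>a b.
            g p (a *\<^sub>R u + b *\<^sub>R v) w = a * g p u w + b * g p v w) \<and>
        (\<exists>b1 \<in> tangent_space A p. \<exists>b2 \<in> tangent_space A p. \<exists>b3 \<in> tangent_space A p.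
            g p b1 b1 = 1 \<and> g p b2 b2 = 1 \<and> g p b3 b3 = -1 \<and>
            g p b1 b2 = 0 \<and> g p b1 b3 = 0 \<and> g p b2 b3 = 0)) \<and>
     (\<forall>c\<in>A. \<forall>i j. smooth_on (cimg c) (\<lambda>x. metric_matrix A g c x $ i $ j))"

text \<open>The value does not depend on the chosen chart, because the charts of an oriented atlas
  induce the same orientation.\<close>

definition volume_form ::
    "'a chart set \<Rightarrow> 'a metric_tensor \<Rightarrow> 'a \<Rightarrow> 'a tvec \<Rightarrow> 'a tvec \<Rightarrow> 'a tvec \<Rightarrow> real" where
  "volume_form A g p u v w =
     (let c = (SOME c. c \<in> A \<and> p \<in> cdom c)
      in sqrt \<bar>det (metric_matrix A g c (cmap c p))\<bar> *
         det (vector [tcomp u c, tcomp v c, tcomp w c] :: real ^ 3 ^ 3))"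


section \<open>The Levi-Civita connection\<close>

text \<open>An affine connection is given by its Christoffel symbols: \<open>G c x u v\<close> is the vector with
  components $\Gamma^k_{ij}(x) u^i v^j$ in the chart \<open>c\<close>. The last condition is the transformation
  law of Christoffel symbols; it makes $\nabla_u V = D V (u) + \Gamma(u, V)$ a tangent vector.\<close>

type_synonym 'a connection = "'a chart \<Rightarrow> real ^ 3 \<Rightarrow> real ^ 3 \<Rightarrow> real ^ 3 \<Rightarrow> real ^ 3"

definition affine_connection :: "'a chart set \<Rightarrow> 'a connection \<Rightarrow> bool" where
  "affine_connection A G \<longleftrightarrow>
     (\<forall>c\<in>A. (\<forall>x \<in> cimg c. bilinear (G c x)) \<and> (\<forall>u v. smooth_on (cimg c) (\<lambda>x. G c x u v))) \<and>
     (\<forall>c\<in>A. \<forall>d\<in>A. \<forall>p \<in> cdom c \<inter> cdom d. \<forall>u v.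
        dtrans c d p (G c (cmap c p) u v) =
          G d (cmap d p) (dtrans c d p u) (dtrans c d p v) +
          frechet_derivative (\<lambda>y. frechet_derivative (transition c d) (at y) v) (at (cmap c p)) u)"

definition torsion_free :: "'a chart set \<Rightarrow> 'a connection \<Rightarrow> bool" where
  "torsion_free A G \<longleftrightarrow> (\<forall>c\<in>A. \<forall>x \<in> cimg c. \<forall>u v. G c x u v = G c x v u)"

text \<open>$\partial_k g_{ij} = g(\nabla_{\partial_k}\partial_i, \partial_j) +
  g(\partial_i, \nabla_{\partial_k}\partial_j)$ in every chart.\<close>

definition metric_compatible ::
    "'a chart set \<Rightarrow> 'a metric_tensor \<Rightarrow> 'a connection \<Rightarrow> bool" where
  "metric_compatible A g G \<longleftrightarrow> (\<forall>c\<in>A. \<forall>x \<in> cimg c. \<forall>i j k.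
     frechet_derivative (\<lambda>y. metric_matrix A g c y $ i $ j) (at x) (axis k 1) =
       (\<Sum>l\<in>UNIV. G c x (axis k 1) (axis i 1) $ l * metric_matrix A g c x $ l $ j) +
       (\<Sum>l\<in>UNIV. G c x (axis k 1) (axis j 1) $ l * metric_matrix A g c x $ i $ l))"

definition levi_civita_connection ::
    "'a chart set \<Rightarrow> 'a metric_tensor \<Rightarrow> 'a connection \<Rightarrow> bool" where
  "levi_civita_connection A g G \<longleftrightarrow>
     affine_connection A G \<and> torsion_free A G \<and> metric_compatible A g G"


section \<open>Curves\<close>

definition smooth_curve ::
    "'a topology \<Rightarrow> 'a chart set \<Rightarrow> real set \<Rightarrow> (real \<Rightarrow> 'a) \<Rightarrow> bool" where
  "smooth_curve M A I \<alpha> \<longleftrightarrow>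
     continuous_map (top_of_set I) M \<alpha> \<and>
     (\<forall>c\<in>A. smooth_on {t \<in> I. \<alpha> t \<in> cdom c} (cmap c \<circ> \<alpha>))"

definition velocity ::
    "'a chart set \<Rightarrow> (real \<Rightarrow> 'a) \<Rightarrow> real \<Rightarrow> 'a tvec" where
  "velocity A \<alpha> t =
     Tvec (\<lambda>c. if c \<in> A \<and> \<alpha> t \<in> cdom c then vector_derivative (cmap c \<circ> \<alpha>) (at t) else 0)"

text \<open>The covariant derivative $\nabla_{\alpha'} V$ of a vector field \<open>V\<close> along \<open>\<alpha>\<close>.\<close>

definition cov_deriv ::
    "'a chart set \<Rightarrow> 'a connection \<Rightarrow> (real \<Rightarrow> 'a) \<Rightarrow> (real \<Rightarrow> 'a tvec) \<Rightarrow> real \<Rightarrow> 'a tvec" where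
  "cov_deriv A G \<alpha> V t =
     Tvec (\<lambda>c. if c \<in> A \<and> \<alpha> t \<in> cdom c
       then vector_derivative (\<lambda>s. tcomp (V s) c) (at t) +
            G c (cmap c (\<alpha> t)) (tcomp (velocity A \<alpha> t) c) (tcomp (V t) c)
       else 0)"

definition accel ::
    "'a chart set \<Rightarrow> 'a connection \<Rightarrow> (real \<Rightarrow> 'a) \<Rightarrow> real \<Rightarrow> 'a tvec" where
  "accel A G \<alpha> = cov_deriv A G \<alpha> (velocity A \<alpha>)"

definition jerk ::
    "'a chart set \<Rightarrow> 'a connection \<Rightarrow> (real \<Rightarrow> 'a) \<Rightarrow> real \<Rightarrow> 'a tvec" where
  "jerk A G \<alpha> = cov_deriv A G \<alpha> (accel A G \<alpha>)"

definition null_curve ::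
    "'a chart set \<Rightarrow> 'a metric_tensor \<Rightarrow> real set \<Rightarrow> (real \<Rightarrow> 'a) \<Rightarrow> bool" where
  "null_curve A g I \<alpha> \<longleftrightarrow> (\<forall>t\<in>I. velocity A \<alpha> t \<noteq> 0 \<and>
     g (\<alpha> t) (velocity A \<alpha> t) (velocity A \<alpha> t) = 0)"

definition nondegenerate_curve ::
    "'a chart set \<Rightarrow> 'a metric_tensor \<Rightarrow> 'a connection \<Rightarrow> real set \<Rightarrow> (real \<Rightarrow> 'a) \<Rightarrow> bool" where
  "nondegenerate_curve A g G I \<alpha> \<longleftrightarrow> (\<forall>t\<in>I.
     volume_form A g (\<alpha> t) (velocity A \<alpha> t) (accel A G \<alpha> t) (jerk A G \<alpha> t) \<noteq> 0)"

definition pseudo_arc_length_parametrized ::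
    "'a chart set \<Rightarrow> 'a metric_tensor \<Rightarrow> 'a connection \<Rightarrow> real set \<Rightarrow> (real \<Rightarrow> 'a) \<Rightarrow> bool" where
  "pseudo_arc_length_parametrized A g G I \<alpha> \<longleftrightarrow>
     (\<forall>t\<in>I. g (\<alpha> t) (accel A G \<alpha> t) (accel A G \<alpha> t) = 1)"


section \<open>Pseudo-torsion and Frenet frame\<close>

definition pseudo_torsion ::
    "'a chart set \<Rightarrow> 'a metric_tensor \<Rightarrow> 'a connection \<Rightarrow> (real \<Rightarrow> 'a) \<Rightarrow> real \<Rightarrow> real" where
  "pseudo_torsion A g G \<alpha> t = 1/2 * g (\<alpha> t) (jerk A G \<alpha> t) (jerk A G \<alpha> t)"

definition frenet_L ::
    "'a chart set \<Rightarrow> (real \<Rightarrow> 'a) \<Rightarrow> real \<Rightarrow> 'a tvec" where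
  "frenet_L A \<alpha> t = velocity A \<alpha> t"

definition frenet_W ::
    "'a chart set \<Rightarrow> 'a connection \<Rightarrow> (real \<Rightarrow> 'a) \<Rightarrow> real \<Rightarrow> 'a tvec" where
  "frenet_W A G \<alpha> t = accel A G \<alpha> t"

definition frenet_N ::
    "'a chart set \<Rightarrow> 'a metric_tensor \<Rightarrow> 'a connection \<Rightarrow> (real \<Rightarrow> 'a) \<Rightarrow> real \<Rightarrow> 'a tvec" where
  "frenet_N A g G \<alpha> t = - jerk A G \<alpha> t - pseudo_torsion A g G \<alpha> t *\<^sub>R velocity A \<alpha> t"


section \<open>Equi-affine speed, Cartan frame and equi-affine curvatures\<close>

definition equiaffine_speed ::
    "'a chart set \<Rightarrow> 'a metric_tensor \<Rightarrow> 'a connection \<Rightarrow> (real \<Rightarrow> 'a) \<Rightarrow> real \<Rightarrow> real" where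
  "equiaffine_speed A g G \<alpha> t =
     root 6 \<bar>volume_form A g (\<alpha> t) (velocity A \<alpha> t) (accel A G \<alpha> t) (jerk A G \<alpha> t)\<bar>"

text \<open>The operator $\nabla_{\mathbf e_1} = \varphi \nabla_{\alpha'}$ with $\varphi = 1/\mu$.\<close>

definition nabla_e1 ::
    "'a chart set \<Rightarrow> 'a metric_tensor \<Rightarrow> 'a connection \<Rightarrow> (real \<Rightarrow> 'a) \<Rightarrow>
     (real \<Rightarrow> 'a tvec) \<Rightarrow> real \<Rightarrow> 'a tvec" where
  "nabla_e1 A g G \<alpha> V t = (1 / equiaffine_speed A g G \<alpha> t) *\<^sub>R cov_deriv A G \<alpha> V t"

definition cartan_e1 ::
    "'a chart set \<Rightarrow> 'a metric_tensor \<Rightarrow> 'a connection \<Rightarrow> (real \<Rightarrow> 'a) \<Rightarrow> real \<Rightarrow> 'a tvec" where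
  "cartan_e1 A g G \<alpha> t = (1 / equiaffine_speed A g G \<alpha> t) *\<^sub>R velocity A \<alpha> t"

definition cartan_e2 ::
    "'a chart set \<Rightarrow> 'a metric_tensor \<Rightarrow> 'a connection \<Rightarrow> (real \<Rightarrow> 'a) \<Rightarrow> real \<Rightarrow> 'a tvec" where
  "cartan_e2 A g G \<alpha> = nabla_e1 A g G \<alpha> (cartan_e1 A g G \<alpha>)"

definition cartan_e3 ::
    "'a chart set \<Rightarrow> 'a metric_tensor \<Rightarrow> 'a connection \<Rightarrow> (real \<Rightarrow> 'a) \<Rightarrow> real \<Rightarrow> 'a tvec" where
  "cartan_e3 A g G \<alpha> = nabla_e1 A g G \<alpha> (cartan_e2 A g G \<alpha>)"

definition equiaffine_curvatures ::
    "'a chart set \<Rightarrow> 'a metric_tensor \<Rightarrow> 'a connection \<Rightarrow> real set \<Rightarrow> (real \<Rightarrow> 'a) \<Rightarrow>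
     (real \<Rightarrow> real) \<Rightarrow> (real \<Rightarrow> real) \<Rightarrow> bool" where
  "equiaffine_curvatures A g G I \<alpha> \<kappa>1 \<kappa>2 \<longleftrightarrow> (\<forall>t\<in>I.
     nabla_e1 A g G \<alpha> (cartan_e3 A g G \<alpha>) t =
       \<kappa>1 t *\<^sub>R cartan_e1 A g G \<alpha> t + \<kappa>2 t *\<^sub>R cartan_e2 A g G \<alpha> t)"

end

theory Submission
  imports Defs
begin

text \<open>Write $Y$ for the jerk $\nabla^2_{\alpha'}\alpha'$ and $Z = \nabla_{\alpha'} Y$. Since
  $\nabla$ is metric, differentiating $g(L,L) = 0$ and $g(W,W) = 1$ repeatedly along the curve
  yields $g(L,W) = g(W,Y) = 0$, $g(L,Y) = -1$, $g(L,Z) = 0$, $g(W,Z) = -2\tau$ and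
  $g(Y,Z) = \tau'$. Hence the Gram matrix of $(L,W,Y)$ has determinant $-1$. The square of
  $\Omega(L,W,Y)$ is the absolute value of this determinant, so $\mu = 1$ and the Cartan frame is
  $(L,W,Y)$. Moreover $Z + \tau' L + 2\tau W$ is orthogonal to the frame $(L,W,Y)$ and therefore
  vanishes.\<close>

section \<open>Calculus of smooth maps\<close>

text \<open>The computation with the products of L, W, Y, Z is short; the weight lies in making it
  legitimate. A tangent vector is a family of components in all charts, \<open>g\<close> obeys its
  axioms on tangent vectors only, and \<open>cov_deriv\<close> is a formula evaluated chart by
  chart. It must therefore be known that the covariant derivative of a tangent field along the curve
  is tangent again, which is where the transformation law of the Christoffel symbols enters, and
  that it is smooth again, since the velocity is covariantly differentiated three times. After that,
  a single Leibniz rule for \<open>g\<close> along the curve yields all products. Two technical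
  points shape the rest. \<open>Ck_on\<close> controls derivatives only in fixed directions, so a
  rule in which the direction varies goes through an expansion in a basis. And derivatives are
  ambient while the fields are uncontrolled outside \<open>I\<close>, so an identity is first proved
  at all parameters in \<open>I\<close> and then differentiated, using that \<open>I\<close> is
  open.\<close>

lemma Ck_on_cong:
  assumes "open S" "\<And>x. x \<in> S \<Longrightarrow> f x = g x" "Ck_on k f S"
  shows "Ck_on k g S"
  using assms(2,3)
proof (induction k arbitrary: f g)
  case 0
  then show ?case using continuous_on_cong[OF refl, of S f g] by simp
next
  case (Suc k)
  have D: "(g has_derivative frechet_derivative f (at x)) (at x)" if "x \<in> S" for x
    using Suc.prems that assms(1)
    by (intro has_derivative_transform_within_open[of f _ x UNIV S g]) (auto simp: frechet_derivative_works)
  then have eq: "frechet_derivative g (at x) = frechet_derivative f (at x)" if "x \<in> S" for x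
    using frechet_derivative_at that by metis
  have "Ck_on k (\<lambda>x. frechet_derivative g (at x) v) S" for v
    by (rule Suc.IH[of "\<lambda>x. frechet_derivative f (at x) v"]) (use Suc.prems eq in auto)
  moreover have "\<forall>x\<in>S. g differentiable (at x)"
    using D by (auto simp: differentiable_def)
  ultimately show ?case by simp
qed

lemma Ck_on_SucD: "Ck_on (Suc k) f S \<Longrightarrow> Ck_on k f S"
proof (induction k arbitrary: f)
  case 0
  then show ?case
    by (auto intro!: continuous_at_imp_continuous_on differentiable_imp_continuous_within)
next
  case (Suc k)
  then show ?case by (metis Ck_on.simps(2))
qed

text \<open>Derivatives are unique, so an explicit family \<open>f'\<close> may stand in for
  \<open>frechet_derivative\<close>; the closure properties below can then take \<open>f'\<close>
  directly from the differentiation rules.\<close>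

lemma Ck_on_SucI:
  assumes "open S" "\<And>x. x \<in> S \<Longrightarrow> (f has_derivative f' x) (at x)"
    "\<And>v. Ck_on k (\<lambda>x. f' x v) S"
  shows "Ck_on (Suc k) f S"
proof -
  have "Ck_on k (\<lambda>x. frechet_derivative f (at x) v) S" for v
    by (rule Ck_on_cong[OF assms(1) _ assms(3)[of v]])
      (metis assms(2) frechet_derivative_at)
  then show ?thesis
    using assms(2) by (auto simp: differentiable_def)
qed

lemma Ck_on_has_derivative:
  "Ck_on (Suc k) f S \<Longrightarrow> x \<in> S \<Longrightarrow> (f has_derivative frechet_derivative f (at x)) (at x)"
  by (simp add: frechet_derivative_works)

lemma Ck_on_const: "open S \<Longrightarrow> Ck_on k (\<lambda>x. c) S"
proof (induction k arbitrary: c)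
  case (Suc k)
  then show ?case by (intro Ck_on_SucI[where f' = "\<lambda>x v. 0"]) auto
qed simp

lemma Ck_on_add:
  assumes "open S" "Ck_on k f S" "Ck_on k g S"
  shows "Ck_on k (\<lambda>x. f x + g x) S"
  using assms(2,3)
proof (induction k arbitrary: f g)
  case (Suc k)
  show ?case
    by (rule Ck_on_SucI[OF assms(1) has_derivative_add[OF Ck_on_has_derivative Ck_on_has_derivative]])
      (use Suc in auto)
qed (simp add: continuous_on_add)

lemma Ck_on_sum:
  assumes "open S" "\<And>i. i \<in> F \<Longrightarrow> Ck_on k (f i) S"
  shows "Ck_on k (\<lambda>x. \<Sum>i\<in>F. f i x) S"
  using assms(2)
  by (induction F rule: infinite_finite_induct) (auto intro: Ck_on_const Ck_on_add assms(1))

lemma Ck_on_bounded_linear: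
  assumes "open S" "bounded_linear h" "Ck_on k f S"
  shows "Ck_on k (\<lambda>x. h (f x)) S"
  using assms(3)
proof (induction k arbitrary: f)
  case 0
  then show ?case by (auto intro: bounded_linear.continuous_on assms(2))
next
  case (Suc k)
  show ?case
    by (rule Ck_on_SucI[OF assms(1) bounded_linear.has_derivative[OF assms(2) Ck_on_has_derivative]])
      (use Suc in auto)
qed

text \<open>The product rule leaves one factor undifferentiated in each term, so the induction step
  also uses \<open>Ck_on_SucD\<close> to lower the class of both factors.\<close>

lemma Ck_on_scaleR:
  assumes "open S" "Ck_on k f S" "Ck_on k g S"
  shows "Ck_on k (\<lambda>x. f x *\<^sub>R g x) S"
  using assms(2,3)
proof (induction k arbitrary: f g)
  case (Suc k)
  show ?case
    by (rule Ck_on_SucI[OF assms(1) has_derivative_scaleR[OF Ck_on_has_derivative Ck_on_has_derivative]])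
      (use Suc Suc.prems[THEN Ck_on_SucD] in \<open>auto intro!: Ck_on_add assms(1)\<close>)
qed (simp add: continuous_on_scaleR)

text \<open>The chain rule applies the derivative of \<open>h\<close> to a direction that moves with
  x, about which \<open>Ck_on\<close> says nothing. Expanding this direction in the basis of the
  intermediate Euclidean space leaves only derivatives of \<open>h\<close> in fixed directions,
  weighted by scalar functions, and the induction hypothesis applies to those.\<close>

lemma Ck_on_compose:
  fixes h :: "'b::euclidean_space \<Rightarrow> 'c::real_normed_vector"
    and f :: "'a::real_normed_vector \<Rightarrow> 'b"
  assumes "open S" "f ` S \<subseteq> T" "Ck_on k h T" "Ck_on k f S"
  shows "Ck_on k (\<lambda>x. h (f x)) S"
  using assms(3,4)
proof (induction k arbitrary: h)
  case 0
  then show ?case using assms(2) continuous_on_compose2 by fastforce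
next
  case (Suc k)
  define h' where "h' x v = (\<Sum>b\<in>Basis. (frechet_derivative f (at x) v \<bullet> b) *\<^sub>R
      frechet_derivative h (at (f x)) b)" for x v
  show ?case
  proof (rule Ck_on_SucI[OF assms(1)])
    fix x assume x: "x \<in> S"
    have h: "(h has_derivative frechet_derivative h (at (f x))) (at (f x))"
      using Ck_on_has_derivative[OF Suc.prems(1)] x assms(2) by blast
    have "h' x v = frechet_derivative h (at (f x)) (frechet_derivative f (at x) v)" for v
    proof -
      have lin: "linear (frechet_derivative h (at (f x)))"
        using h has_derivative_linear by blast
      have "h' x v = frechet_derivative h (at (f x)) (\<Sum>b\<in>Basis. (frechet_derivative f (at x) v \<bullet> b) *\<^sub>R b)"
        unfolding h'_def by (simp only: linear_sum[OF lin] linear_scale[OF lin])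
      then show ?thesis
        by (simp only: euclidean_representation)
    qed
    moreover have "((\<lambda>x. h (f x)) has_derivative
        (\<lambda>v. frechet_derivative h (at (f x)) (frechet_derivative f (at x) v))) (at x)"
      by (rule has_derivative_compose[OF Ck_on_has_derivative[OF Suc.prems(2) x] h])
    ultimately show "((\<lambda>x. h (f x)) has_derivative h' x) (at x)" by presburger
  next
    fix v
    have "Ck_on k (\<lambda>x. frechet_derivative f (at x) v \<bullet> b) S" for b
      by (rule Ck_on_bounded_linear[OF assms(1) bounded_linear_inner_left]) (use Suc.prems in auto)
    moreover have "Ck_on k (\<lambda>x. frechet_derivative h (at (f x)) b) S" for b
      by (rule Suc.IH) (use Suc.prems Ck_on_SucD in auto)
    ultimately show "Ck_on k (\<lambda>x. h' x v) S"
      unfolding h'_def by (intro Ck_on_sum Ck_on_scaleR assms(1))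
  qed
qed

lemma smooth_on_cong:
  "open S \<Longrightarrow> (\<And>x. x \<in> S \<Longrightarrow> f x = g x) \<Longrightarrow> smooth_on S f \<Longrightarrow> smooth_on S g"
  unfolding smooth_on_def using Ck_on_cong by blast

lemma smooth_on_add: "open S \<Longrightarrow> smooth_on S f \<Longrightarrow> smooth_on S g \<Longrightarrow> smooth_on S (\<lambda>x. f x + g x)"
  by (simp add: smooth_on_def Ck_on_add)

lemma smooth_on_compose:
  fixes h :: "'b::euclidean_space \<Rightarrow> 'c::real_normed_vector"
  shows "open S \<Longrightarrow> f ` S \<subseteq> T \<Longrightarrow> smooth_on T h \<Longrightarrow> smooth_on S f \<Longrightarrow> smooth_on S (\<lambda>x. h (f x))"
  by (simp add: smooth_on_def Ck_on_compose)

lemma smooth_on_has_derivative: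
  "smooth_on S f \<Longrightarrow> x \<in> S \<Longrightarrow> (f has_derivative frechet_derivative f (at x)) (at x)"
  unfolding smooth_on_def using Ck_on_has_derivative by blast

lemma smooth_on_frechet_derivative:
  "smooth_on S f \<Longrightarrow> smooth_on S (\<lambda>x. frechet_derivative f (at x) v)"
  unfolding smooth_on_def using Ck_on.simps(2) by blast

lemma smooth_on_has_vector_derivative:
  fixes f :: "real \<Rightarrow> 'a::real_normed_vector"
  assumes "smooth_on S f" "t \<in> S"
  shows "(f has_vector_derivative vector_derivative f (at t)) (at t)"
  using smooth_on_has_derivative[OF assms] differentiableI vector_derivative_works
  by blast

lemma smooth_on_vector_derivative:
  fixes f :: "real \<Rightarrow> 'a::real_normed_vector"
  assumes "open S" "smooth_on S f"
  shows "smooth_on S (\<lambda>t. vector_derivative f (at t))"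
proof (rule smooth_on_cong[OF assms(1) _ smooth_on_frechet_derivative[OF assms(2), of 1]])
  fix t assume "t \<in> S"
  then show "frechet_derivative f (at t) 1 = vector_derivative f (at t)"
    using fun_cong[OF frechet_derivative_at[OF smooth_on_has_vector_derivative[OF assms(2),
          unfolded has_vector_derivative_def]], of t 1]
    by simp
qed

section \<open>Families of linear maps applied to varying vectors\<close>

lemma linear_apply_axis:
  fixes F :: "real ^ 'n \<Rightarrow> 'b::real_vector"
  assumes "linear F"
  shows "F v = (\<Sum>i\<in>UNIV. v $ i *\<^sub>R F (axis i 1))"
proof -
  have "v = (\<Sum>i\<in>UNIV. v $ i *\<^sub>R axis i 1)"
    using basis_expansion[of v] by (simp add: scalar_mult_eq_scaleR)
  then have "F v = F (\<Sum>i\<in>UNIV. v $ i *\<^sub>R axis i 1)"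
    by (rule arg_cong)
  then show ?thesis
    by (simp only: linear_sum[OF assms] linear_scale[OF assms])
qed

lemma bilinear_expansion:
  fixes f :: "real ^ 'm \<Rightarrow> real ^ 'n \<Rightarrow> real"
  assumes "bilinear f"
  shows "f a b = (\<Sum>i\<in>UNIV. \<Sum>j\<in>UNIV. a $ i * b $ j * f (axis i 1) (axis j 1))"
proof -
  have l: "linear (\<lambda>a. f a b)" and r: "linear (f a)" for a b
    using assms by (auto simp: bilinear_def)
  show ?thesis
    by (subst linear_apply_axis[OF l, where v = a], subst linear_apply_axis[OF r, where v = b])
      (simp add: sum_distrib_left mult.assoc)
qed

text \<open>Smoothness of \<open>F\<close> is required pointwise in its linear argument, which is
  the form in which the Christoffel symbols are given; finite dimension makes this enough.\<close>

lemma smooth_on_apply_linear: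
  fixes F :: "'a::real_normed_vector \<Rightarrow> real ^ 'n \<Rightarrow> 'b::real_normed_vector"
  assumes "open S" "\<And>x. x \<in> S \<Longrightarrow> linear (F x)" "\<And>v. smooth_on S (\<lambda>x. F x v)" "smooth_on S V"
  shows "smooth_on S (\<lambda>x. F x (V x))"
proof (rule smooth_on_cong[OF assms(1)])
  show "(\<Sum>i\<in>UNIV. V x $ i *\<^sub>R F x (axis i 1)) = F x (V x)" if "x \<in> S" for x
    by (rule linear_apply_axis[OF assms(2)[OF that], symmetric])
  show "smooth_on S (\<lambda>x. \<Sum>i\<in>UNIV. V x $ i *\<^sub>R F x (axis i 1))"
    using assms(3,4) unfolding smooth_on_def
    by (intro allI Ck_on_sum Ck_on_scaleR assms(1) Ck_on_bounded_linear[OF assms(1) bounded_linear_vec_nth]) auto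
qed

lemma has_vector_derivative_compose:
  assumes "(f has_vector_derivative f') (at t)" "(h has_derivative h') (at (f t))"
  shows "((\<lambda>s. h (f s)) has_vector_derivative h' f') (at t)"
  using has_derivative_compose[OF assms(1)[unfolded has_vector_derivative_def] assms(2)]
    linear_scale[OF has_derivative_linear[OF assms(2)]]
  by (simp add: has_vector_derivative_def)

text \<open>A Leibniz rule for a moving linear map on a moving vector. It serves for the Jacobians
  of the transition maps and for each slot of the metric.\<close>

lemma has_vector_derivative_apply_linear:
  fixes F :: "real \<Rightarrow> real ^ 'n \<Rightarrow> 'b::real_normed_vector"
  assumes S: "open S" "t \<in> S" and lin: "\<And>s. s \<in> S \<Longrightarrow> linear (F s)"
    and F': "\<And>v. ((\<lambda>s. F s v) has_vector_derivative F' v) (at t)"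
    and V': "(V has_vector_derivative V') (at t)"
  shows "((\<lambda>s. F s (V s)) has_vector_derivative F' (V t) + F t V') (at t)"
proof -
  have gen: "((\<lambda>s. F s (U s)) has_vector_derivative
      (\<Sum>i\<in>UNIV. U t $ i *\<^sub>R F' (axis i 1) + U' $ i *\<^sub>R F t (axis i 1))) (at t)"
    if "(U has_vector_derivative U') (at t)" for U U'
  proof (rule has_vector_derivative_transform_within_open[OF _ S])
    show "(\<Sum>i\<in>UNIV. U s $ i *\<^sub>R F s (axis i 1)) = F s (U s)" if "s \<in> S" for s
      by (rule linear_apply_axis[OF lin[OF that], symmetric])
    show "((\<lambda>s. \<Sum>i\<in>UNIV. U s $ i *\<^sub>R F s (axis i 1)) has_vector_derivative
      (\<Sum>i\<in>UNIV. U t $ i *\<^sub>R F' (axis i 1) + U' $ i *\<^sub>R F t (axis i 1))) (at t)"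
      using bounded_linear.has_vector_derivative[OF bounded_linear_vec_nth that]
      by (intro has_vector_derivative_sum has_vector_derivative_scaleR F')
        (simp add: has_real_derivative_iff_has_vector_derivative)
  qed
  \<comment> \<open>Linearity of \<open>F'\<close> is not assumed. It is recovered at
    \<open>V t\<close> by applying \<open>gen\<close> to the constant vector \<open>V t\<close> and
    using uniqueness of the derivative.\<close>
  have "F' (V t) = (\<Sum>i\<in>UNIV. V t $ i *\<^sub>R F' (axis i 1))"
  proof (rule vector_derivative_unique_at[OF F'])
    show "((\<lambda>s. F s (V t)) has_vector_derivative (\<Sum>i\<in>UNIV. V t $ i *\<^sub>R F' (axis i 1))) (at t)"
      using gen[of "\<lambda>s. V t" 0] by simp
  qed
  with gen[OF V'] linear_apply_axis[OF lin[OF S(2)], of V'] show ?thesis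
    by (simp add: sum.distrib)
qed

section \<open>Tangent vectors and the metric in a chart\<close>

lemma tcomp_zero [simp]: "tcomp 0 c = 0"
  and tcomp_add [simp]: "tcomp (u + v) c = tcomp u c + tcomp v c"
  and tcomp_minus [simp]: "tcomp (- u) c = - tcomp u c"
  and tcomp_diff [simp]: "tcomp (u - v) c = tcomp u c - tcomp v c"
  and tcomp_scaleR [simp]: "tcomp (r *\<^sub>R u) c = r *\<^sub>R tcomp u c"
  by (simp_all add: zero_tvec_def plus_tvec_def uminus_tvec_def minus_tvec_def scaleR_tvec_def)

lemma tcomp_sum [simp]: "tcomp (\<Sum>i\<in>F. u i) c = (\<Sum>i\<in>F. tcomp (u i) c)"
  by (induction F rule: infinite_finite_induct) auto

lemma tvec_eqI: "(\<And>c. tcomp u c = tcomp v c) \<Longrightarrow> u = v"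
  by (cases u; cases v) (auto simp: fun_eq_iff)

lemma vector_3_in: "(vector [u, v, w] :: 'b::zero ^ 3) $ i \<in> {u, v, w}"
  using exhaust_3[of i] by auto

locale lorentzian_manifold =
  fixes M :: "'a topology" and A :: "'a chart set"
    and g :: "'a metric_tensor" and G :: "'a connection"
  assumes atlas: "smooth_atlas M A"
    and metric: "lorentzian_metric M A g"
    and levi_civita: "levi_civita_connection A g G"
begin

section \<open>Charts and the Jacobians of transition maps\<close>

lemma chart_at: "p \<in> topspace M \<Longrightarrow> \<exists>c\<in>A. p \<in> cdom c"
  using atlas unfolding smooth_atlas_def by blast

lemma openin_cdom: "c \<in> A \<Longrightarrow> openin M (cdom c)"
  using atlas unfolding smooth_atlas_def by blast

lemma homeomorphic_cmap:
  "c \<in> A \<Longrightarrow> homeomorphic_map (subtopology M (cdom c)) (top_of_set (cimg c)) (cmap c)"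
  using atlas unfolding smooth_atlas_def by blast

lemma cdom_subset_topspace: "c \<in> A \<Longrightarrow> cdom c \<subseteq> topspace M"
  using openin_cdom openin_subset by blast

lemma cinv_cmap:
  assumes "c \<in> A" "p \<in> cdom c"
  shows "cinv c (cmap c p) = p"
  using homeomorphic_imp_injective_map[OF homeomorphic_cmap[OF assms(1)]]
    cdom_subset_topspace[OF assms(1)] assms(2)
  by (simp add: Int_absorb1 topspace_subtopology)

text \<open>Provides the open sets of coordinate space on which two transition maps can be compared
  before differentiating.\<close>

lemma open_cmap_image:
  assumes c: "c \<in> A" and U: "openin M U" "U \<subseteq> cdom c"
  shows "open (cmap c ` U)"
proof -
  have "openin (subtopology M (cdom c)) U"
    using U by (simp add: openin_open_subtopology[OF openin_cdom[OF c]])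
  then have "openin (top_of_set (cimg c)) (cmap c ` U)"
    using homeomorphic_imp_open_map[OF homeomorphic_cmap[OF c]] unfolding open_map_def by blast
  moreover have "open (cimg c)"
    using atlas c unfolding smooth_atlas_def by blast
  ultimately show ?thesis
    using openin_open_trans by blast
qed

lemma transition_cmap:
  "c \<in> A \<Longrightarrow> p \<in> cdom c \<Longrightarrow> transition c d (cmap c p) = cmap d p"
  by (simp add: transition_def cinv_cmap)

lemma smooth_on_transition:
  "c \<in> A \<Longrightarrow> d \<in> A \<Longrightarrow> smooth_on (cmap c ` (cdom c \<inter> cdom d)) (transition c d)"
  using atlas unfolding smooth_atlas_def by blast

lemma has_derivative_transition:
  assumes "c \<in> A" "d \<in> A" "p \<in> cdom c" "p \<in> cdom d"
  shows "(transition c d has_derivative dtrans c d p) (at (cmap c p))"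
  unfolding dtrans_def
  by (rule smooth_on_has_derivative[OF smooth_on_transition]) (use assms in auto)

lemma linear_dtrans:
  "c \<in> A \<Longrightarrow> d \<in> A \<Longrightarrow> p \<in> cdom c \<Longrightarrow> p \<in> cdom d \<Longrightarrow> linear (dtrans c d p)"
  using has_derivative_transition has_derivative_linear by blast

text \<open>The cocycle identity: the chain rule for the composed transition, which coincides with
  the direct one on the image of the triple overlap, an open set.\<close>

lemma dtrans_dtrans:
  assumes "c \<in> A" "d \<in> A" "e \<in> A" "p \<in> cdom c" "p \<in> cdom d" "p \<in> cdom e"
  shows "dtrans d e p (dtrans c d p v) = dtrans c e p v"
proof -
  let ?U = "cdom c \<inter> cdom d \<inter> cdom e"
  have "((\<lambda>x. transition d e (transition c d x)) has_derivative
      (\<lambda>v. dtrans d e p (dtrans c d p v))) (at (cmap c p))"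
    by (rule has_derivative_compose[OF has_derivative_transition])
      (use assms has_derivative_transition in \<open>auto simp: transition_cmap\<close>)
  then have "(transition c e has_derivative (\<lambda>v. dtrans d e p (dtrans c d p v))) (at (cmap c p))"
  proof (rule has_derivative_transform_within_open)
    show "open (cmap c ` ?U)"
      using assms by (intro open_cmap_image openin_Int openin_cdom) auto
    show "transition d e (transition c d x) = transition c e x" if "x \<in> cmap c ` ?U" for x
      using that assms by (auto simp: transition_cmap)
  qed (use assms in auto)
  from has_derivative_unique[OF this has_derivative_transition[of c e p]] assms show ?thesis
    by (simp add: fun_eq_iff)
qed

lemma dtrans_self:
  assumes "c \<in> A" "p \<in> cdom c"
  shows "dtrans c c p v = v"
proof -
  have "(transition c c has_derivative (\<lambda>v. v)) (at (cmap c p))"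
  proof (rule has_derivative_transform_within_open[OF has_derivative_ident])
    show "open (cmap c ` cdom c)"
      by (rule open_cmap_image) (use assms openin_cdom in auto)
  qed (use assms in \<open>auto simp: transition_cmap\<close>)
  from has_derivative_unique[OF this has_derivative_transition[of c c p]] assms show ?thesis
    by (simp add: fun_eq_iff)
qed

section \<open>Tangent spaces and coordinate vectors\<close>

lemma tangent_space_outside:
  "v \<in> tangent_space A p \<Longrightarrow> \<not> (c \<in> A \<and> p \<in> cdom c) \<Longrightarrow> tcomp v c = 0"
  unfolding tangent_space_def by blast

lemma tangent_space_transform:
  "v \<in> tangent_space A p \<Longrightarrow> c \<in> A \<Longrightarrow> d \<in> A \<Longrightarrow> p \<in> cdom c \<Longrightarrow> p \<in> cdom d \<Longrightarrow>
    tcomp v d = dtrans c d p (tcomp v c)"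
  unfolding tangent_space_def by blast

lemma tangent_spaceI:
  assumes "\<And>c. \<not> (c \<in> A \<and> p \<in> cdom c) \<Longrightarrow> tcomp v c = 0"
    and "\<And>c d. c \<in> A \<Longrightarrow> d \<in> A \<Longrightarrow> p \<in> cdom c \<Longrightarrow> p \<in> cdom d \<Longrightarrow>
      dtrans c d p (tcomp v c) = tcomp v d"
  shows "v \<in> tangent_space A p"
  using assms unfolding tangent_space_def by (simp del: split_paired_All)

lemma subspace_tangent_space: "subspace (tangent_space A p)"
  unfolding subspace_def
proof (intro conjI allI ballI)
  show "0 \<in> tangent_space A p"
    by (rule tangent_spaceI) (simp_all add: linear_0[OF linear_dtrans])
next
  fix u v assume uv: "u \<in> tangent_space A p" "v \<in> tangent_space A p"
  show "u + v \<in> tangent_space A p"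
    by (rule tangent_spaceI) (simp_all add: linear_add[OF linear_dtrans]
        uv[THEN tangent_space_outside] tangent_space_transform[OF uv(1), symmetric]
        tangent_space_transform[OF uv(2), symmetric])
next
  fix r v assume v: "v \<in> tangent_space A p"
  show "r *\<^sub>R v \<in> tangent_space A p"
    by (rule tangent_spaceI) (simp_all add: linear_scale[OF linear_dtrans]
        v[THEN tangent_space_outside] tangent_space_transform[OF v, symmetric])
qed

text \<open>One chart determines a tangent vector: the transformation law fixes the components in
  the other charts around \<open>p\<close>, and those in the remaining charts are zero by
  convention.\<close>

lemma tangent_space_eqI:
  assumes u: "u \<in> tangent_space A p" and v: "v \<in> tangent_space A p"
    and c: "c \<in> A" "p \<in> cdom c" and eq: "tcomp u c = tcomp v c"
  shows "u = v"
proof (rule tvec_eqI)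
  fix d
  show "tcomp u d = tcomp v d"
  proof (cases "d \<in> A \<and> p \<in> cdom d")
    case True
    then show ?thesis
      using tangent_space_transform[OF u c(1) _ c(2)] tangent_space_transform[OF v c(1) _ c(2)] eq
      by (metis (no_types))
  next
    case False
    then show ?thesis
      using u v tangent_space_outside by metis
  qed
qed

text \<open>For coordinate vectors the transformation law is exactly the cocycle identity of the
  Jacobians.\<close>

lemma coord_vec_in_tangent_space:
  "c \<in> A \<Longrightarrow> p \<in> cdom c \<Longrightarrow> coord_vec A c p i \<in> tangent_space A p"
  unfolding tangent_space_def coord_vec_def by (auto simp: dtrans_dtrans)

lemma tangent_vector_expansion:
  assumes "v \<in> tangent_space A p" "c \<in> A" "p \<in> cdom c"
  shows "v = (\<Sum>i\<in>UNIV. tcomp v c $ i *\<^sub>R coord_vec A c p i)"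
proof (rule tangent_space_eqI[OF assms(1) _ assms(2,3)])
  show "(\<Sum>i\<in>UNIV. tcomp v c $ i *\<^sub>R coord_vec A c p i) \<in> tangent_space A p"
    by (intro subspace_sum subspace_scale subspace_tangent_space coord_vec_in_tangent_space assms)
  show "tcomp v c = tcomp (\<Sum>i\<in>UNIV. tcomp v c $ i *\<^sub>R coord_vec A c p i) c"
    using assms linear_apply_axis[OF linear_id, of "tcomp v c"]
    by (simp add: coord_vec_def dtrans_self)
qed

section \<open>The metric and its coordinate expression\<close>

lemma metric_sym:
  "p \<in> topspace M \<Longrightarrow> u \<in> tangent_space A p \<Longrightarrow> v \<in> tangent_space A p \<Longrightarrow> g p u v = g p v u"
  using metric unfolding lorentzian_metric_def by blast

lemma metric_linear_left:
  "p \<in> topspace M \<Longrightarrow> u \<in> tangent_space A p \<Longrightarrow> v \<in> tangent_space A p \<Longrightarrow> w \<in> tangent_space A p \<Longrightarrow>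
    g p (a *\<^sub>R u + b *\<^sub>R v) w = a * g p u w + b * g p v w"
  using metric unfolding lorentzian_metric_def by blast

text \<open>The axioms cover only combinations of two tangent vectors, so the induction also has to
  check that partial sums stay tangent.\<close>

lemma metric_sum_left:
  assumes "p \<in> topspace M" "\<And>i. i \<in> F \<Longrightarrow> u i \<in> tangent_space A p" "w \<in> tangent_space A p"
  shows "g p (\<Sum>i\<in>F. a i *\<^sub>R u i) w = (\<Sum>i\<in>F. a i * g p (u i) w)"
proof -
  have 0: "g p 0 w = 0"
    using metric_linear_left[OF assms(1) _ _ assms(3), of 0 0 0 0] subspace_0[OF subspace_tangent_space]
    by simp
  show ?thesis
    using assms(2)
  proof (induction F rule: infinite_finite_induct)
    case (insert i F)
    have "(\<Sum>i\<in>F. a i *\<^sub>R u i) \<in> tangent_space A p"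
      by (intro subspace_sum subspace_scale subspace_tangent_space insert.prems) simp
    then show ?case
      using metric_linear_left[OF assms(1) _ _ assms(3), of "u i" "\<Sum>i\<in>F. a i *\<^sub>R u i" "a i" 1] insert
      by simp
  qed (simp_all add: 0)
qed

text \<open>Unlike \<open>g\<close>, this form is bilinear on all of coordinate space, without side
  conditions on tangency, and can be differentiated in its base point with the vectors held
  fixed.\<close>

definition cmetric :: "'a chart \<Rightarrow> real ^ 3 \<Rightarrow> real ^ 3 \<Rightarrow> real ^ 3 \<Rightarrow> real" where
  "cmetric c x a b = a \<bullet> (metric_matrix A g c x *v b)"

lemma cmetric_expand:
  "cmetric c x a b = (\<Sum>i\<in>UNIV. \<Sum>j\<in>UNIV. a $ i * b $ j * metric_matrix A g c x $ i $ j)"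
  by (simp add: cmetric_def inner_vec_def matrix_vector_mult_def sum_distrib_left algebra_simps)

lemma bilinear_cmetric: "bilinear (cmetric c x)"
  unfolding bilinear_def cmetric_def
  by (auto intro!: linearI simp: algebra_simps inner_simps matrix_vector_right_distrib
      matrix_vector_mult_scaleR)

text \<open>Both vectors are expanded in coordinate vectors. Linearity is given in the first slot
  only; symmetry transfers it to the second.\<close>

lemma metric_eq_cmetric:
  assumes p: "p \<in> topspace M" and uv: "u \<in> tangent_space A p" "v \<in> tangent_space A p"
    and c: "c \<in> A" "p \<in> cdom c"
  shows "g p u v = cmetric c (cmap c p) (tcomp u c) (tcomp v c)"
proof -
  let ?e = "coord_vec A c p"
  have e: "?e i \<in> tangent_space A p" for i
    by (rule coord_vec_in_tangent_space[OF c])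
  have left: "g p v (?e i) = (\<Sum>j\<in>UNIV. tcomp v c $ j * g p (?e j) (?e i))" for i
    by (rule trans[OF arg_cong[OF tangent_vector_expansion[OF uv(2) c], of "\<lambda>x. g p x (?e i)"]
          metric_sum_left[OF p e e]])
  have right: "g p (?e i) v = (\<Sum>j\<in>UNIV. tcomp v c $ j * g p (?e i) (?e j))" for i
    unfolding metric_sym[OF p e uv(2)] left
    by (intro sum.cong refl arg_cong2[where f = "(*)"] metric_sym p e)
  have "g p u v = (\<Sum>i\<in>UNIV. tcomp u c $ i * g p (?e i) v)"
    by (rule trans[OF arg_cong[OF tangent_vector_expansion[OF uv(1) c], of "\<lambda>x. g p x v"]
          metric_sum_left[OF p e uv(2)]])
  then show ?thesis
    by (simp add: right cmetric_expand metric_matrix_def cinv_cmap[OF c] sum_distrib_left mult.assoc)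
qed

lemma bilinear_connection: "c \<in> A \<Longrightarrow> x \<in> cimg c \<Longrightarrow> bilinear (G c x)"
  using levi_civita unfolding levi_civita_connection_def affine_connection_def by blast

text \<open>Metric compatibility is stated for coordinate vectors alone. Linearity in the direction
  \<open>u\<close> and bilinearity in \<open>a\<close>, \<open>b\<close> extend it from basis
  vectors to arbitrary ones.\<close>

lemma has_derivative_cmetric:
  assumes c: "c \<in> A" and x: "x \<in> cimg c"
  shows "((\<lambda>y. cmetric c y a b) has_derivative
    (\<lambda>u. cmetric c x (G c x u a) b + cmetric c x a (G c x u b))) (at x)"
proof -
  let ?m = "\<lambda>i j y. metric_matrix A g c y $ i $ j"
  define D where "D i j = frechet_derivative (?m i j) (at x)" for i j
  have m: "(?m i j has_derivative D i j) (at x)" for i j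
    unfolding D_def using metric c x
    by (intro smooth_on_has_derivative) (auto simp: lorentzian_metric_def)
  have Gl: "linear (\<lambda>u. G c x u a)" and Gr: "linear (G c x a)" for a
    using bilinear_connection[OF c x] by (auto simp: bilinear_def)
  have gl: "linear (\<lambda>u. cmetric c x u a)" and gr: "linear (cmetric c x a)" for a
    using bilinear_cmetric by (auto simp: bilinear_def)
  have D_axis: "D i j (axis k 1) =
      cmetric c x (G c x (axis k 1) (axis i 1)) (axis j 1) +
      cmetric c x (axis i 1) (G c x (axis k 1) (axis j 1))" for i j k
  proof -
    have "cmetric c x a (axis j 1) = (\<Sum>l\<in>UNIV. a $ l * ?m l j x)"
      "cmetric c x (axis i 1) a = (\<Sum>l\<in>UNIV. a $ l * ?m i l x)" for a i j
      unfolding cmetric_def matrix_vector_mult_basis inner_axis'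
      by (simp_all add: inner_vec_def column_def matrix_vector_mult_def mult.commute)
    moreover have "D i j (axis k 1) =
       (\<Sum>l\<in>UNIV. G c x (axis k 1) (axis i 1) $ l * ?m l j x) +
       (\<Sum>l\<in>UNIV. G c x (axis k 1) (axis j 1) $ l * ?m i l x)"
      using levi_civita c x unfolding levi_civita_connection_def metric_compatible_def D_def by blast
    ultimately show ?thesis by simp
  qed
  have lin: "linear (\<lambda>u. cmetric c x (G c x u a) b + cmetric c x a (G c x u b))" for a b
    using linear_compose[OF Gl[of a] gl[of b]] linear_compose[OF Gl[of b] gr[of a]]
    by (auto simp: o_def intro: linear_compose_add)
  have D: "D i j u = cmetric c x (G c x u (axis i 1)) (axis j 1) +
      cmetric c x (axis i 1) (G c x u (axis j 1))" for i j u
    by (simp only: linear_apply_axis[OF has_derivative_linear[OF m], where v = u] D_axis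
        linear_apply_axis[OF lin, where v = u])
  have bil: "bilinear (\<lambda>a b. cmetric c x (G c x u a) b + cmetric c x a (G c x u b))" for u
    unfolding bilinear_def
  proof (intro conjI allI linear_compose_add gl gr)
    show "linear (\<lambda>b. cmetric c x a (G c x u b))" for a
      using linear_compose[OF Gr[of u] gr[of a]] by (simp add: o_def)
    show "linear (\<lambda>a. cmetric c x (G c x u a) b)" for b
      using linear_compose[OF Gr[of u] gl[of b]] by (simp add: o_def)
  qed
  have "((\<lambda>y. cmetric c y a b) has_derivative (\<lambda>u. \<Sum>i\<in>UNIV. \<Sum>j\<in>UNIV. a $ i * b $ j * D i j u)) (at x)"
    unfolding cmetric_expand by (intro has_derivative_sum has_derivative_mult_right m)
  also have "(\<lambda>u. \<Sum>i\<in>UNIV. \<Sum>j\<in>UNIV. a $ i * b $ j * D i j u) =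
      (\<lambda>u. cmetric c x (G c x u a) b + cmetric c x a (G c x u b))"
    unfolding D by (rule ext) (rule bilinear_expansion[OF bil, symmetric])
  finally show ?thesis .
qed

end

section \<open>Covariant differentiation along a curve\<close>

locale lorentzian_curve = lorentzian_manifold M A g G
  for M :: "'a topology" and A g G +
  fixes I :: "real set" and \<alpha> :: "real \<Rightarrow> 'a"
  assumes open_I: "open I"
    and curve: "smooth_curve M A I \<alpha>"
begin

text \<open>The parameters at which calculations in the chart \<open>c\<close> are valid. This set
  is open, so derivatives along the curve may be computed inside it.\<close>

definition chart_times :: "'a chart \<Rightarrow> real set" where
  "chart_times c = {t \<in> I. \<alpha> t \<in> cdom c}"

lemma chart_times_iff: "t \<in> chart_times c \<longleftrightarrow> t \<in> I \<and> \<alpha> t \<in> cdom c"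
  by (simp add: chart_times_def)

lemma open_chart_times:
  assumes "c \<in> A"
  shows "open (chart_times c)"
proof -
  have "openin (top_of_set I) {t \<in> topspace (top_of_set I). \<alpha> t \<in> cdom c}"
    using curve openin_cdom[OF assms] unfolding smooth_curve_def
    by (blast intro: openin_continuous_map_preimage)
  then show ?thesis
    unfolding chart_times_def using openin_open_trans[OF _ open_I] by simp
qed

lemma curve_in_topspace: "t \<in> I \<Longrightarrow> \<alpha> t \<in> topspace M"
  using curve continuous_map_image_subset_topspace[of "top_of_set I" M \<alpha>]
  unfolding smooth_curve_def by auto

lemma curve_chart:
  assumes "t \<in> I"
  obtains c where "c \<in> A" "t \<in> chart_times c"
  using chart_at[OF curve_in_topspace[OF assms]] assms by (auto simp: chart_times_iff)

lemma smooth_coordinates: "c \<in> A \<Longrightarrow> smooth_on (chart_times c) (\<lambda>t. cmap c (\<alpha> t))"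
  using curve unfolding smooth_curve_def chart_times_def o_def by blast

text \<open>The invariant carried through repeated covariant differentiation: tangency gives access
  to the axioms of \<open>g\<close>, smoothness to the next derivative.\<close>

definition smooth_field :: "(real \<Rightarrow> 'a tvec) \<Rightarrow> bool" where
  "smooth_field V \<longleftrightarrow> (\<forall>t\<in>I. V t \<in> tangent_space A (\<alpha> t)) \<and>
     (\<forall>c\<in>A. smooth_on (chart_times c) (\<lambda>t. tcomp (V t) c))"

lemma smooth_field_tangent: "smooth_field V \<Longrightarrow> t \<in> I \<Longrightarrow> V t \<in> tangent_space A (\<alpha> t)"
  unfolding smooth_field_def by blast

lemma smooth_field_tcomp: "smooth_field V \<Longrightarrow> c \<in> A \<Longrightarrow> smooth_on (chart_times c) (\<lambda>t. tcomp (V t) c)"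
  unfolding smooth_field_def by blast

lemma smooth_field_has_vector_derivative:
  "smooth_field V \<Longrightarrow> c \<in> A \<Longrightarrow> t \<in> chart_times c \<Longrightarrow>
    ((\<lambda>s. tcomp (V s) c) has_vector_derivative vector_derivative (\<lambda>s. tcomp (V s) c) (at t)) (at t)"
  by (rule smooth_on_has_vector_derivative[OF smooth_field_tcomp])

lemma coordinates_has_vector_derivative:
  assumes "c \<in> A" "t \<in> chart_times c"
  shows "((\<lambda>s. cmap c (\<alpha> s)) has_vector_derivative tcomp (velocity A \<alpha> t) c) (at t)"
  using smooth_on_has_vector_derivative[OF smooth_coordinates] assms
  by (simp add: velocity_def chart_times_iff o_def)

lemma tcomp_cov_deriv:
  "c \<in> A \<Longrightarrow> t \<in> chart_times c \<Longrightarrow> tcomp (cov_deriv A G \<alpha> V t) c =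
    vector_derivative (\<lambda>s. tcomp (V s) c) (at t) +
    G c (cmap c (\<alpha> t)) (tcomp (velocity A \<alpha> t) c) (tcomp (V t) c)"
  by (simp add: cov_deriv_def chart_times_iff)

lemma velocity_transform:
  assumes "c \<in> A" "d \<in> A" "t \<in> chart_times c" "t \<in> chart_times d"
  shows "dtrans c d (\<alpha> t) (tcomp (velocity A \<alpha> t) c) = tcomp (velocity A \<alpha> t) d"
proof (rule vector_derivative_unique_at[OF _ coordinates_has_vector_derivative[OF assms(2,4)]])
  have "((\<lambda>s. transition c d (cmap c (\<alpha> s))) has_vector_derivative
      dtrans c d (\<alpha> t) (tcomp (velocity A \<alpha> t) c)) (at t)"
    using assms by (intro has_vector_derivative_compose[OF coordinates_has_vector_derivative]
        has_derivative_transition) (auto simp: chart_times_iff)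
  then show "((\<lambda>s. cmap d (\<alpha> s)) has_vector_derivative
      dtrans c d (\<alpha> t) (tcomp (velocity A \<alpha> t) c)) (at t)"
    by (rule has_vector_derivative_transform_within_open[OF _ open_chart_times[OF assms(1)] assms(3)])
      (use assms in \<open>auto simp: transition_cmap chart_times_iff\<close>)
qed

lemma smooth_field_velocity: "smooth_field (velocity A \<alpha>)"
  unfolding smooth_field_def
proof (intro conjI ballI)
  fix t assume "t \<in> I"
  then show "velocity A \<alpha> t \<in> tangent_space A (\<alpha> t)"
    by (intro tangent_spaceI velocity_transform) (auto simp: chart_times_iff velocity_def)
next
  fix c assume c: "c \<in> A"
  show "smooth_on (chart_times c) (\<lambda>t. tcomp (velocity A \<alpha> t) c)"
    by (rule smooth_on_cong[OF open_chart_times[OF c] _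
          smooth_on_vector_derivative[OF open_chart_times[OF c] smooth_coordinates[OF c]]])
      (use c in \<open>auto simp: velocity_def chart_times_iff o_def\<close>)
qed

text \<open>Neither summand of the covariant derivative is a vector by itself. Differentiating the
  transformation law of \<open>V\<close> along the curve adds a second derivative of the transition
  map, and the inhomogeneous term in the law of the Christoffel symbols cancels it.\<close>

lemma cov_deriv_transform:
  assumes V: "smooth_field V" and cd: "c \<in> A" "d \<in> A" and t: "t \<in> chart_times c" "t \<in> chart_times d"
  shows "dtrans c d (\<alpha> t) (tcomp (cov_deriv A G \<alpha> V t) c) = tcomp (cov_deriv A G \<alpha> V t) d"
proof -
  let ?T = "dtrans c d (\<alpha> t)" and ?x = "cmap c (\<alpha> t)"
  let ?S = "chart_times c \<inter> chart_times d"
  let ?V' = "\<lambda>c. vector_derivative (\<lambda>s. tcomp (V s) c) (at t)"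
  define u v where "u = tcomp (velocity A \<alpha> t) c" and "v = tcomp (V t) c"
  \<comment> \<open>\<open>H w\<close> is the rate of change along the curve of the Jacobian applied
    to the fixed vector \<open>w\<close>; \<open>H v\<close> is the term that has to cancel.\<close>
  define H where "H w = frechet_derivative (\<lambda>y. frechet_derivative (transition c d) (at y) w) (at ?x) u"
    for w
  have S: "open ?S" "t \<in> ?S"
    using cd t by (simp_all add: open_Int open_chart_times)
  have p: "\<alpha> t \<in> cdom c" "\<alpha> t \<in> cdom d" "t \<in> I"
    using t by (auto simp: chart_times_iff)
  have "((\<lambda>s. dtrans c d (\<alpha> s) w) has_vector_derivative H w) (at t)" for w
    unfolding dtrans_def H_def u_def
    by (rule has_vector_derivative_compose[OF coordinates_has_vector_derivative[OF cd(1) t(1)]])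
      (rule smooth_on_has_derivative[OF smooth_on_frechet_derivative[OF smooth_on_transition[OF cd]]],
        use p in blast)
  then have "((\<lambda>s. dtrans c d (\<alpha> s) (tcomp (V s) c)) has_vector_derivative H v + ?T (?V' c)) (at t)"
    unfolding v_def
    by (intro has_vector_derivative_apply_linear[OF S]
        smooth_field_has_vector_derivative[OF V cd(1) t(1)])
      (use cd in \<open>auto simp: chart_times_iff intro: linear_dtrans\<close>)
  then have "((\<lambda>s. tcomp (V s) d) has_vector_derivative H v + ?T (?V' c)) (at t)"
  proof (rule has_vector_derivative_transform_within_open[OF _ S])
    show "dtrans c d (\<alpha> s) (tcomp (V s) c) = tcomp (V s) d" if "s \<in> ?S" for s
      using tangent_space_transform[OF smooth_field_tangent[OF V] cd] that
      by (simp add: chart_times_iff)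
  qed
  then have V'd: "?V' d = H v + ?T (?V' c)"
    by (rule vector_derivative_at)
  have "?T (G c ?x u v) = G d (cmap d (\<alpha> t)) (?T u) (?T v) + H v"
    using levi_civita cd p
    unfolding levi_civita_connection_def affine_connection_def H_def by blast
  moreover have "?T u = tcomp (velocity A \<alpha> t) d"
    unfolding u_def by (rule velocity_transform[OF cd t])
  moreover have "?T v = tcomp (V t) d"
    unfolding v_def
    by (rule tangent_space_transform[OF smooth_field_tangent[OF V p(3)] cd p(1,2), symmetric])
  ultimately show ?thesis
    unfolding tcomp_cov_deriv[OF cd(1) t(1)] tcomp_cov_deriv[OF cd(2) t(2)]
      linear_add[OF linear_dtrans[OF cd p(1,2)]] V'd u_def[symmetric] v_def[symmetric]
    by simp
qed

lemma smooth_field_cov_deriv: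
  assumes V: "smooth_field V"
  shows "smooth_field (cov_deriv A G \<alpha> V)"
  unfolding smooth_field_def
proof (intro conjI ballI)
  fix t assume "t \<in> I"
  then show "cov_deriv A G \<alpha> V t \<in> tangent_space A (\<alpha> t)"
    by (intro tangent_spaceI cov_deriv_transform[OF V]) (auto simp: chart_times_iff cov_deriv_def)
next
  fix c assume c: "c \<in> A"
  let ?S = "chart_times c"
  note S = open_chart_times[OF c]
  have x: "cmap c (\<alpha> s) \<in> cimg c" if "s \<in> ?S" for s
    using that by (auto simp: chart_times_iff)
  have lin: "linear (\<lambda>u. G c (cmap c (\<alpha> s)) u v)" "linear (G c (cmap c (\<alpha> s)) v)" if "s \<in> ?S" for s v
    using bilinear_connection[OF c x[OF that]] unfolding bilinear_def by auto
  \<comment> \<open>The Christoffel symbols are smooth for fixed arguments only, so the moving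
    velocity and the moving field are inserted one slot at a time.\<close>
  have G0: "smooth_on ?S (\<lambda>s. G c (cmap c (\<alpha> s)) u v)" for u v
  proof (rule smooth_on_compose[OF S _ _ smooth_coordinates[OF c]])
    show "smooth_on (cimg c) (\<lambda>x. G c x u v)"
      using levi_civita c unfolding levi_civita_connection_def affine_connection_def by blast
  qed (use x in blast)
  have G1: "smooth_on ?S (\<lambda>s. G c (cmap c (\<alpha> s)) (tcomp (velocity A \<alpha> s) c) v)" for v
    by (rule smooth_on_apply_linear[where F = "\<lambda>s u. G c (cmap c (\<alpha> s)) u v", OF S lin(1) G0
          smooth_field_tcomp[OF smooth_field_velocity c]])
  have G2: "smooth_on ?S (\<lambda>s. G c (cmap c (\<alpha> s)) (tcomp (velocity A \<alpha> s) c) (tcomp (V s) c))"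
    by (rule smooth_on_apply_linear[where F = "\<lambda>s. G c (cmap c (\<alpha> s)) (tcomp (velocity A \<alpha> s) c)",
          OF S lin(2) G1 smooth_field_tcomp[OF V c]])
  show "smooth_on ?S (\<lambda>t. tcomp (cov_deriv A G \<alpha> V t) c)"
    by (rule smooth_on_cong[OF S tcomp_cov_deriv[OF c, symmetric]
          smooth_on_add[OF S smooth_on_vector_derivative[OF S smooth_field_tcomp[OF V c]] G2]])
qed

text \<open>In a chart there are three sources of change: the base point and the components of each
  field. Metric compatibility turns the first into two Christoffel terms, which complete the other
  two to covariant derivatives.\<close>

lemma has_real_derivative_metric:
  assumes V: "smooth_field V" and W: "smooth_field W" and t: "t \<in> I"
  shows "((\<lambda>s. g (\<alpha> s) (V s) (W s)) has_real_derivative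
    g (\<alpha> t) (cov_deriv A G \<alpha> V t) (W t) + g (\<alpha> t) (V t) (cov_deriv A G \<alpha> W t)) (at t)"
proof -
  obtain c where c: "c \<in> A" "t \<in> chart_times c"
    using curve_chart[OF t] .
  let ?S = "chart_times c" and ?x = "cmap c (\<alpha> t)"
  let ?g = "\<lambda>s. cmetric c (cmap c (\<alpha> s))"
  define u v w v' w' where "u = tcomp (velocity A \<alpha> t) c"
    and "v = tcomp (V t) c" and "w = tcomp (W t) c"
    and "v' = vector_derivative (\<lambda>s. tcomp (V s) c) (at t)"
    and "w' = vector_derivative (\<lambda>s. tcomp (W s) c) (at t)"
  note defs = u_def v_def w_def v'_def w'_def
  have lin: "linear (\<lambda>a. ?g s a b)" "linear (?g s b)" for s b
    using bilinear_cmetric unfolding bilinear_def by blast+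
  have "((\<lambda>s. ?g s a b) has_vector_derivative
      cmetric c ?x (G c ?x u a) b + cmetric c ?x a (G c ?x u b)) (at t)" for a b
    unfolding u_def
    by (rule has_vector_derivative_compose[OF coordinates_has_vector_derivative[OF c]
          has_derivative_cmetric[OF c(1)]])
      (use c in \<open>auto simp: chart_times_iff\<close>)
  from has_vector_derivative_apply_linear[where F = "\<lambda>s a. ?g s a b" for b,
      OF open_chart_times[OF c(1)] c(2) lin(1) this smooth_field_has_vector_derivative[OF V c]]
  have "((\<lambda>s. ?g s (tcomp (V s) c) b) has_vector_derivative
      cmetric c ?x (G c ?x u v) b + cmetric c ?x v (G c ?x u b) + cmetric c ?x v' b) (at t)" for b
    unfolding defs .
  from has_vector_derivative_apply_linear[where F = "\<lambda>s. ?g s (tcomp (V s) c)",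
      OF open_chart_times[OF c(1)] c(2) lin(2) this smooth_field_has_vector_derivative[OF W c]]
  have "((\<lambda>s. ?g s (tcomp (V s) c) (tcomp (W s) c)) has_vector_derivative
      cmetric c ?x (G c ?x u v) w + cmetric c ?x v (G c ?x u w) + cmetric c ?x v' w
      + cmetric c ?x v w') (at t)"
    unfolding defs .
  also have "cmetric c ?x (G c ?x u v) w + cmetric c ?x v (G c ?x u w) + cmetric c ?x v' w
      + cmetric c ?x v w' = cmetric c ?x (v' + G c ?x u v) w + cmetric c ?x v (w' + G c ?x u w)"
    by (simp add: linear_add[OF lin(1)] linear_add[OF lin(2)])
  also have "\<dots> = g (\<alpha> t) (cov_deriv A G \<alpha> V t) (W t) + g (\<alpha> t) (V t) (cov_deriv A G \<alpha> W t)"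
    using c t smooth_field_tangent V W smooth_field_cov_deriv curve_in_topspace
    by (simp add: metric_eq_cmetric[where c = c] tcomp_cov_deriv[OF c] defs chart_times_iff)
  finally have "((\<lambda>s. ?g s (tcomp (V s) c) (tcomp (W s) c)) has_vector_derivative
      g (\<alpha> t) (cov_deriv A G \<alpha> V t) (W t) + g (\<alpha> t) (V t) (cov_deriv A G \<alpha> W t)) (at t)" .
  then show ?thesis
    unfolding has_real_derivative_iff_has_vector_derivative
  proof (rule has_vector_derivative_transform_within_open[OF _ open_chart_times[OF c(1)] c(2)])
    show "?g s (tcomp (V s) c) (tcomp (W s) c) = g (\<alpha> s) (V s) (W s)" if "s \<in> ?S" for s
      using metric_eq_cmetric[OF curve_in_topspace smooth_field_tangent[OF V] smooth_field_tangent[OF W] c(1)]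
        that by (simp add: chart_times_iff)
  qed
qed

lemma metric_cov_deriv_const:
  assumes V: "smooth_field V" and W: "smooth_field W" and t: "t \<in> I"
    and k: "\<And>s. s \<in> I \<Longrightarrow> g (\<alpha> s) (V s) (W s) = k"
  shows "g (\<alpha> t) (cov_deriv A G \<alpha> V t) (W t) + g (\<alpha> t) (V t) (cov_deriv A G \<alpha> W t) = 0"
proof (rule DERIV_unique[OF has_real_derivative_metric[OF V W t]])
  show "((\<lambda>s. g (\<alpha> s) (V s) (W s)) has_real_derivative 0) (at t)"
    by (rule has_field_derivative_transform_within_open[OF DERIV_const[of k] open_I t]) (simp add: k)
qed

text \<open>Near a point of the open set \<open>I\<close> the two fields coincide, so their ambient
  derivatives agree. This lets the Cartan frame, which is identified on \<open>I\<close> only, be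
  differentiated.\<close>

lemma cov_deriv_cong:
  assumes "t \<in> I" "\<And>s. s \<in> I \<Longrightarrow> V s = W s"
  shows "cov_deriv A G \<alpha> V t = cov_deriv A G \<alpha> W t"
proof -
  have "\<forall>\<^sub>F s in nhds t. V s = W s"
    using open_I assms by (auto simp: eventually_nhds)
  then have eq: "vector_derivative (\<lambda>s. tcomp (V s) c) (at t) = vector_derivative (\<lambda>s. tcomp (W s) c) (at t)" for c
    by (intro vector_derivative_cong_eq) (auto elim: eventually_mono)
  show ?thesis
    by (simp only: cov_deriv_def eq assms)
qed

end

section \<open>Gram determinants and the volume form\<close>

context lorentzian_manifold
begin

definition gram :: "'a \<Rightarrow> 'a tvec \<Rightarrow> 'a tvec \<Rightarrow> 'a tvec \<Rightarrow> real ^ 3 ^ 3" where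
  "gram p u v w = (\<chi> i j. g p (vector [u, v, w] $ i) (vector [u, v, w] $ j))"

text \<open>The rows of \<open>B\<close> are the three vectors in coordinates, so this is the
  congruence by which a bilinear form changes under substitution of vectors.\<close>

lemma gram_eq_matrix:
  assumes p: "p \<in> topspace M" and uvw: "{u, v, w} \<subseteq> tangent_space A p" and c: "c \<in> A" "p \<in> cdom c"
  defines "B \<equiv> (vector [tcomp u c, tcomp v c, tcomp w c] :: real ^ 3 ^ 3)"
  shows "gram p u v w = B ** metric_matrix A g c (cmap c p) ** transpose B"
proof -
  let ?m = "metric_matrix A g c (cmap c p)" and ?U = "vector [u, v, w] :: 'a tvec ^ 3"
  have B: "B $ i = tcomp (?U $ i) c" for i
    using exhaust_3[of i] unfolding B_def by auto
  have "gram p u v w $ i $ j = cmetric c (cmap c p) (B $ i) (B $ j)" for i j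
    using vector_3_in[of u v w] uvw unfolding gram_def vec_lambda_beta B
    by (intro metric_eq_cmetric[OF p _ _ c]) blast+
  also have "cmetric c (cmap c p) (B $ i) (B $ j) = (B ** ?m ** transpose B) $ i $ j" for i j
    unfolding matrix_mul_assoc[symmetric]
    by (simp add: cmetric_def matrix_matrix_mult_def inner_vec_def matrix_vector_mult_def transpose_def)
  finally show ?thesis
    by (simp add: vec_eq_iff)
qed

text \<open>Both sides equal the absolute value of the determinant of the metric matrix times the
  square of the determinant of the components. The right side mentions no chart, so the chart
  selected by \<open>SOME\<close> is immaterial.\<close>

lemma volume_form_squared:
  assumes p: "p \<in> topspace M" and uvw: "{u, v, w} \<subseteq> tangent_space A p"
  shows "(volume_form A g p u v w)\<^sup>2 = \<bar>det (gram p u v w)\<bar>"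
proof -
  define c where "c = (SOME c. c \<in> A \<and> p \<in> cdom c)"
  have c: "c \<in> A" "p \<in> cdom c"
    using someI_ex[of "\<lambda>c. c \<in> A \<and> p \<in> cdom c"] chart_at[OF p] unfolding c_def by blast+
  show ?thesis
    unfolding volume_form_def c_def[symmetric] Let_def gram_eq_matrix[OF p uvw c] det_mul det_transpose
    by (simp add: power_mult_distrib abs_mult mult.assoc mult.left_commute power2_eq_square)
qed

text \<open>The matrix \<open>?B ** ?m\<close> sends the components of \<open>x\<close> to its
  products with \<open>u\<close>, \<open>v\<close>, \<open>w\<close>. A nonzero Gram determinant
  forces this matrix to be invertible.\<close>

lemma eq_0_if_orthogonal:
  assumes p: "p \<in> topspace M" and uvw: "{u, v, w} \<subseteq> tangent_space A p"
    and det: "det (gram p u v w) \<noteq> 0"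
    and x: "x \<in> tangent_space A p" "g p u x = 0" "g p v x = 0" "g p w x = 0"
  shows "x = 0"
proof -
  obtain c where c: "c \<in> A" "p \<in> cdom c"
    using chart_at[OF p] by blast
  let ?m = "metric_matrix A g c (cmap c p)"
  let ?B = "vector [tcomp u c, tcomp v c, tcomp w c] :: real ^ 3 ^ 3"
  have "det (?B ** ?m) \<noteq> 0"
    using det unfolding gram_eq_matrix[OF p uvw c] det_mul by simp
  moreover have "(?B ** ?m) *v tcomp x c = 0"
  proof -
    have "((?B ** ?m) *v tcomp x c) $ i = cmetric c (cmap c p) (?B $ i) (tcomp x c)" for i
      by (simp add: cmetric_def matrix_vector_mul_assoc[symmetric] matrix_vector_mul_component)
    moreover have "cmetric c (cmap c p) (?B $ i) (tcomp x c) = 0" for i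
      using exhaust_3[of i] uvw x metric_eq_cmetric[OF p _ x(1) c] by auto
    ultimately show ?thesis
      by (simp add: vec_eq_iff)
  qed
  ultimately have "tcomp x c = 0"
    using invertible_det_nz matrix_left_invertible_ker invertible_left_inverse by blast
  then show ?thesis
    using tangent_space_eqI[OF x(1) subspace_0[OF subspace_tangent_space] c] by simp
qed

end

section \<open>Null curves parametrized by pseudo-arc length\<close>

locale pseudo_arc_length_null_curve = lorentzian_curve +
  assumes null: "null_curve A g I \<alpha>"
    and pseudo_arc_length: "pseudo_arc_length_parametrized A g G I \<alpha>"
begin

abbreviation "L \<equiv> velocity A \<alpha>"
abbreviation "W \<equiv> accel A G \<alpha>"
abbreviation "Y \<equiv> jerk A G \<alpha>"
abbreviation "Z \<equiv> cov_deriv A G \<alpha> Y"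
abbreviation "\<tau> \<equiv> pseudo_torsion A g G \<alpha>"

lemma smooth_frame: "smooth_field L" "smooth_field W" "smooth_field Y" "smooth_field Z"
proof -
  show *: "smooth_field L" "smooth_field W" "smooth_field Y"
    unfolding jerk_def accel_def by (intro smooth_field_cov_deriv smooth_field_velocity)+
  show "smooth_field Z"
    by (rule smooth_field_cov_deriv[OF *(3)])
qed

lemmas frame_tangent = smooth_frame[THEN smooth_field_tangent]

text \<open>Each relation is the derivative of an earlier one: LL gives LW, WW gives WY, LW gives LY
  through the product WW = 1, LY gives LZ, and WY gives WZ.\<close>

lemma frame_products:
  assumes t: "t \<in> I"
  shows "g (\<alpha> t) (L t) (L t) = 0" "g (\<alpha> t) (W t) (W t) = 1" "g (\<alpha> t) (Y t) (Y t) = 2 * \<tau> t"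
    "g (\<alpha> t) (L t) (W t) = 0" "g (\<alpha> t) (L t) (Y t) = -1" "g (\<alpha> t) (W t) (Y t) = 0"
    "g (\<alpha> t) (L t) (Z t) = 0" "g (\<alpha> t) (W t) (Z t) = - 2 * \<tau> t"
    "(\<tau> has_real_derivative g (\<alpha> t) (Y t) (Z t)) (at t)"
proof -
  have sym: "g (\<alpha> s) (V s) (V' s) = g (\<alpha> s) (V' s) (V s)"
    if "s \<in> I" "smooth_field V" "smooth_field V'" for V V' s
    using that by (intro metric_sym curve_in_topspace smooth_field_tangent)
  have step: "g (\<alpha> s) (cov_deriv A G \<alpha> V s) (V' s) + g (\<alpha> s) (V s) (cov_deriv A G \<alpha> V' s) = 0"
    if "\<forall>s\<in>I. g (\<alpha> s) (V s) (V' s) = k" "smooth_field V" "smooth_field V'" "s \<in> I" for V V' k s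
    using metric_cov_deriv_const that by blast
  note W = accel_def[of A G \<alpha>, symmetric] and Y = jerk_def[of A G \<alpha>, symmetric]
  have LL: "\<forall>s\<in>I. g (\<alpha> s) (L s) (L s) = 0"
    using null unfolding null_curve_def by blast
  have WW: "\<forall>s\<in>I. g (\<alpha> s) (W s) (W s) = 1"
    using pseudo_arc_length unfolding pseudo_arc_length_parametrized_def by blast
  have LW: "\<forall>s\<in>I. g (\<alpha> s) (L s) (W s) = 0"
    using step[OF LL smooth_frame(1,1)] sym[OF _ smooth_frame(1,2)] unfolding W by fastforce
  have WY: "\<forall>s\<in>I. g (\<alpha> s) (W s) (Y s) = 0"
    using step[OF WW smooth_frame(2,2)] sym[OF _ smooth_frame(2,3)] unfolding Y by fastforce
  have LY: "\<forall>s\<in>I. g (\<alpha> s) (L s) (Y s) = -1"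
    using step[OF LW smooth_frame(1,2)] WW unfolding W Y by fastforce
  have YY: "\<forall>s\<in>I. g (\<alpha> s) (Y s) (Y s) = 2 * \<tau> s"
    by (simp add: pseudo_torsion_def)
  have LZ: "\<forall>s\<in>I. g (\<alpha> s) (L s) (Z s) = 0"
    using step[OF LY smooth_frame(1,3)] WY unfolding W by fastforce
  have WZ: "\<forall>s\<in>I. g (\<alpha> s) (W s) (Z s) = - 2 * \<tau> s"
    using step[OF WY smooth_frame(2,3)] YY unfolding Y by fastforce
  show "g (\<alpha> t) (L t) (L t) = 0" "g (\<alpha> t) (W t) (W t) = 1" "g (\<alpha> t) (Y t) (Y t) = 2 * \<tau> t"
    "g (\<alpha> t) (L t) (W t) = 0" "g (\<alpha> t) (L t) (Y t) = -1" "g (\<alpha> t) (W t) (Y t) = 0"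
    "g (\<alpha> t) (L t) (Z t) = 0" "g (\<alpha> t) (W t) (Z t) = - 2 * \<tau> t"
    using t LL WW YY LW LY WY LZ WZ by blast+
  \<comment> \<open>The factor 1/2 in the pseudo-torsion absorbs the two equal terms in the
    derivative of g(Y,Y).\<close>
  show "(\<tau> has_real_derivative g (\<alpha> t) (Y t) (Z t)) (at t)"
    using DERIV_cmult[OF has_real_derivative_metric[OF smooth_frame(3,3) t], of "1/2"]
      sym[OF t smooth_frame(3,4)]
    by (simp add: pseudo_torsion_def[abs_def])
qed

text \<open>The rows are (0, 0, -1), (0, 1, 0), (-1, 0, 2\<tau>); the entry 2\<tau> has cofactor
  zero, so the determinant does not depend on \<tau>.\<close>

lemma det_gram_frame:
  assumes t: "t \<in> I"
  shows "det (gram (\<alpha> t) (L t) (W t) (Y t)) = -1"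
proof -
  have "g (\<alpha> t) (W t) (L t) = 0" "g (\<alpha> t) (Y t) (L t) = -1" "g (\<alpha> t) (Y t) (W t) = 0"
    using frame_products[OF t] metric_sym[OF curve_in_topspace[OF t]] frame_tangent[OF t] by metis+
  then show ?thesis
    using frame_products[OF t] by (simp add: gram_def det_3)
qed

text \<open>The volume is 1 or -1 according to the orientation of the frame, and the absolute value
  in the speed removes this sign.\<close>

lemma equiaffine_speed_eq_1:
  assumes t: "t \<in> I"
  shows "equiaffine_speed A g G \<alpha> t = 1"
proof -
  have "(volume_form A g (\<alpha> t) (L t) (W t) (Y t))\<^sup>2 = 1"
    using volume_form_squared[OF curve_in_topspace[OF t], of "L t" "W t" "Y t"]
      det_gram_frame[OF t] frame_tangent[OF t] by simp
  then show ?thesis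
    unfolding equiaffine_speed_def by (auto simp: power2_eq_1_iff)
qed

lemma cov_deriv_jerk:
  assumes t: "t \<in> I"
  shows "Z t = (- deriv \<tau> t) *\<^sub>R L t + (- 2 * \<tau> t) *\<^sub>R W t"
proof -
  let ?p = "\<alpha> t"
  \<comment> \<open>The coefficients come from the ansatz Z = aL + bW + cY: the product with L gives
    c = 0, that with W gives b = -2\<tau>, and that with Y then gives -a = \<tau>'.\<close>
  define X where "X = Z t - ((- deriv \<tau> t) *\<^sub>R L t + (- 2 * \<tau> t) *\<^sub>R W t)"
  note p = curve_in_topspace[OF t] and tan = frame_tangent[OF t]
  note sub = subspace_tangent_space[of ?p]
  have X: "X \<in> tangent_space A ?p"
    unfolding X_def by (intro subspace_diff subspace_add subspace_scale sub tan)
  have prod: "g ?p v X = g ?p v (Z t) + deriv \<tau> t * g ?p v (L t) + 2 * \<tau> t * g ?p v (W t)"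
    if v: "v \<in> tangent_space A ?p" for v
  proof -
    \<comment> \<open>The unit scalars bring \<open>X\<close> into the shape of the linearity axiom,
      which is then used twice.\<close>
    have eq: "X = 1 *\<^sub>R Z t + 1 *\<^sub>R (deriv \<tau> t *\<^sub>R L t + (2 * \<tau> t) *\<^sub>R W t)"
      by (simp add: X_def algebra_simps)
    have "deriv \<tau> t *\<^sub>R L t + (2 * \<tau> t) *\<^sub>R W t \<in> tangent_space A ?p"
      by (intro subspace_add subspace_scale sub tan)
    then have "g ?p X v = g ?p (Z t) v + deriv \<tau> t * g ?p (L t) v + 2 * \<tau> t * g ?p (W t) v"
      unfolding eq
      by (simp only: metric_linear_left[OF p tan(4) _ v] metric_linear_left[OF p tan(1,2) v]) simp
    then show ?thesis
      using metric_sym[OF p _ v] X tan by simp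
  qed
  have "g ?p (Y t) (L t) = -1" "g ?p (Y t) (W t) = 0" "g ?p (W t) (L t) = 0"
    using frame_products[OF t] metric_sym[OF p] tan by metis+
  moreover have "deriv \<tau> t = g ?p (Y t) (Z t)"
    by (rule DERIV_imp_deriv[OF frame_products(9)[OF t]])
  ultimately have "X = 0"
    using frame_products[OF t] tan X det_gram_frame[OF t]
    by (intro eq_0_if_orthogonal[OF p, of "L t" "W t" "Y t"]) (simp_all add: prod)
  then show ?thesis by (simp add: X_def)
qed

section \<open>Cartan frame and equi-affine curvatures\<close>

lemma nabla_e1_eq_cov_deriv: "t \<in> I \<Longrightarrow> nabla_e1 A g G \<alpha> V t = cov_deriv A G \<alpha> V t"
  by (simp add: nabla_e1_def equiaffine_speed_eq_1)

lemma cartan_frame: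
  assumes "t \<in> I"
  shows "cartan_e1 A g G \<alpha> t = L t" "cartan_e2 A g G \<alpha> t = W t" "cartan_e3 A g G \<alpha> t = Y t"
proof -
  \<comment> \<open>Equality at the single given parameter would not survive differentiation, so
    each identity is proved on all of \<open>I\<close> before the next field is formed.\<close>
  have 1: "cartan_e1 A g G \<alpha> t = L t" if "t \<in> I" for t
    using that by (simp add: cartan_e1_def equiaffine_speed_eq_1)
  have 2: "cartan_e2 A g G \<alpha> t = W t" if "t \<in> I" for t
    unfolding cartan_e2_def nabla_e1_eq_cov_deriv[OF that] accel_def
    by (rule cov_deriv_cong[OF that 1])
  have 3: "cartan_e3 A g G \<alpha> t = Y t" if "t \<in> I" for t
    unfolding cartan_e3_def nabla_e1_eq_cov_deriv[OF that] jerk_def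
    by (rule cov_deriv_cong[OF that 2])
  show "cartan_e1 A g G \<alpha> t = L t" "cartan_e2 A g G \<alpha> t = W t" "cartan_e3 A g G \<alpha> t = Y t"
    using assms 1 2 3 by auto
qed

text \<open>The product with W isolates the coefficient of W, and the product with Y that of L; L
  itself is orthogonal to both L and W and detects neither. This gives the uniqueness of the
  curvatures.\<close>

lemma velocity_accel_independent:
  assumes t: "t \<in> I" and eq: "a *\<^sub>R L t + b *\<^sub>R W t = a' *\<^sub>R L t + b' *\<^sub>R W t"
  shows "a = a'" "b = b'"
proof -
  note p = curve_in_topspace[OF t] and tan = frame_tangent[OF t]
  have "a * g (\<alpha> t) (L t) v + b * g (\<alpha> t) (W t) v = a' * g (\<alpha> t) (L t) v + b' * g (\<alpha> t) (W t) v"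
    if "v \<in> tangent_space A (\<alpha> t)" for v
    using metric_linear_left[OF p tan(1,2) that] eq by metis
  from this[OF tan(2)] this[OF tan(3)] show "a = a'" "b = b'"
    by (simp_all add: frame_products[OF t])
qed

lemma equiaffine_curvatures_iff:
  "equiaffine_curvatures A g G I \<alpha> \<kappa>1 \<kappa>2 \<longleftrightarrow>
    (\<forall>t\<in>I. \<kappa>1 t = - deriv \<tau> t \<and> \<kappa>2 t = - 2 * \<tau> t)"
proof -
  have "nabla_e1 A g G \<alpha> (cartan_e3 A g G \<alpha>) t =
      (- deriv \<tau> t) *\<^sub>R L t + (- 2 * \<tau> t) *\<^sub>R W t" if "t \<in> I" for t
    unfolding nabla_e1_eq_cov_deriv[OF that] cov_deriv_jerk[OF that, symmetric]
    by (rule cov_deriv_cong[OF that cartan_frame(3)])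
  then show ?thesis
    unfolding equiaffine_curvatures_def
    using velocity_accel_independent by (auto simp: cartan_frame simp del: scaleR_minus_left) metis+
qed

end

theorem theorem3:
  fixes M :: "'a topology" and A :: "'a chart set"
    and g :: "'a metric_tensor" and G :: "'a connection"
    and I :: "real set" and \<alpha> :: "real \<Rightarrow> 'a"
  assumes "connected_oriented_3_manifold M A"
    and "lorentzian_metric M A g"
    and "levi_civita_connection A g G"
    and "open I" and "is_interval I" and "I \<noteq> {}"
    and "smooth_curve M A I \<alpha>"
    and "null_curve A g I \<alpha>"
    and "nondegenerate_curve A g G I \<alpha>"
    and "pseudo_arc_length_parametrized A g G I \<alpha>"
  shows "(\<forall>t\<in>I. equiaffine_speed A g G \<alpha> t = 1) \<and>
    (\<forall>t\<in>I. cartan_e1 A g G \<alpha> t = frenet_L A \<alpha> t \<and>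
      cartan_e2 A g G \<alpha> t = frenet_W A G \<alpha> t \<and>
      cartan_e3 A g G \<alpha> t =
        - (pseudo_torsion A g G \<alpha> t *\<^sub>R frenet_L A \<alpha> t) - frenet_N A g G \<alpha> t) \<and>
    (\<forall>\<kappa>1 \<kappa>2. equiaffine_curvatures A g G I \<alpha> \<kappa>1 \<kappa>2 \<longleftrightarrow>
      (\<forall>t\<in>I. \<kappa>1 t = - deriv (pseudo_torsion A g G \<alpha>) t \<and>
        \<kappa>2 t = - 2 * pseudo_torsion A g G \<alpha> t))"
proof -
  interpret pseudo_arc_length_null_curve M A g G I \<alpha>
    using assms by unfold_locales (simp_all add: connected_oriented_3_manifold_def)
  show ?thesis
    \<comment> \<open>For the third frame vector, \<open>frenet_N_def\<close> turns -\<tau>L - N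
      into -\<tau>L + Y + \<tau>L, which is the jerk Y.\<close>
    by (simp add: equiaffine_speed_eq_1 cartan_frame equiaffine_curvatures_iff
        frenet_L_def frenet_W_def frenet_N_def)
qed

end
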